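(* Let an instance of 3-SAT with variables $x_1,\ldots,x_p$ and clauses $c_1,\ldots,c_q$ be given, in which no variable occurs twice (in either complemented or plain form) in any particular clause. Let $P\subset\mathbb{R}^{3p+q}$ be the polyhedron of all points $(\mathbf{s},\mathbf{t},\mathbf{u},\mathbf{v})$ with $\mathbf{s},\mathbf{t},\mathbf{u}\in\mathbb{R}^p$, $\mathbf{v}\in\mathbb{R}^q$ satisfying $$\mathbf{0}\le\mathbf{s}\le\mathbf{u},\quad \mathbf{0}\le\mathbf{t}\le\mathbf{u},\quad \mathbf{0}\le\mathbf{u}\le\mathbf{e},\quad \mathbf{v}\ge\mathbf{0},$$ $$s_i-2t_i\le v_j\ \text{ whenever } \tilde x_i\in c_j,\qquad 2t_i-2s_i-u_i\le v_j\ \text{ whenever } x_i\in c_j.$$ Let $S\subset\mathbb{R}^{3p+q}$ be the set consisting of the points $$\mathbf{0},\qquad \left(\tfrac{1}{4p}\mathbf{e},\tfrac{1}{4p}\mathbf{e},\tfrac{1}{2p}\mathbf{e},\tfrac{2.5}{8p}\mathbf{e}\right),\qquad (\mathbf{0},\mathbf{0},\mathbf{0},\mathbf{e}_j)\quad (j=1,\ldots,q),$$ and, for each $i=1,\ldots,p$, $$\left(\mathbf{0},\tfrac14\mathbf{e}_i,\tfrac12\mathbf{e}_i,\mathbf{e}\right),\quad \left(\tfrac12\mathbf{e}_i,\tfrac14\mathbf{e}_i,\tfrac12\mathbf{e}_i,\mathbf{e}\right),\quad \left(\tfrac14\mathbf{e}_i,\tfrac18\mathbf{e}_i,\tfrac12\mathbf{e}_i,\mathbf{e}\right),\quad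 \left(\tfrac14\mathbf{e}_i,\tfrac38\mathbf{e}_i,\tfrac12\mathbf{e}_i,\mathbf{e}\right).$$ Then the 3-SAT instance has a satisfying assignment if and only if there exists a $(3p+q)$-simplex $T$ such that $S\subset T\subset P$.
   Context: 3-SAT: there are $p$ boolean variables $x_1,\ldots,x_p$ and $q$ clauses $c_1,\ldots,c_q$; each clause is a disjunction of three literals, where a literal is either a variable $x_i$ or its complement $\tilde x_i$; $x_i\in c_j$ (resp. $\tilde x_i\in c_j$) means that this literal occurs in clause $c_j$. A satisfying assignment is an assignment of $0$ or $1$ to each variable such that every clause has at least one literal equal to $1$. Vector inequalities are entrywise. $\mathbf{e}$ denotes the all-ones vector (in $\mathbb{R}^p$ or $\mathbb{R}^q$ as appropriate), and $\mathbf{e}_i$ denotes the $i$th column of the identity matrix ($p\times p$ or $q\times q$ as appropriate). A $(3p+q)$-simplex is the convex hull of $3p+q+1$ affinely independent points. *)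

theory Defs
  imports "HOL-Analysis.Analysis"
begin

datatype 'p lit = Pos 'p | Neg 'p

primrec lit_var :: "'p lit \<Rightarrow> 'p" where
  "lit_var (Pos i) = i"
| "lit_var (Neg i) = i"

primrec lit_true :: "('p \<Rightarrow> bool) \<Rightarrow> 'p lit \<Rightarrow> bool" where
  "lit_true a (Pos i) \<longleftrightarrow> a i"
| "lit_true a (Neg i) \<longleftrightarrow> \<not> a i"

text \<open>A clause is the list of its literals, so that repetitions can be expressed.\<close>

type_synonym 'p clause = "'p lit list"

definition is_3sat :: "('q \<Rightarrow> 'p clause) \<Rightarrow> bool" where
  "is_3sat c \<longleftrightarrow> (\<forall>j. length (c j) = 3)"

definition no_repeated_var :: "('q \<Rightarrow> 'p clause) \<Rightarrow> bool" where
  "no_repeated_var c \<longleftrightarrow> (\<forall>j. distinct (map lit_var (c j)))"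

definition satisfiable :: "('q \<Rightarrow> 'p clause) \<Rightarrow> bool" where
  "satisfiable c \<longleftrightarrow> (\<exists>a. \<forall>j. \<exists>l \<in> set (c j). lit_true a l)"

text \<open>
  The Euclidean space of dimension \<open>3p + q\<close> is the product space below, where
  \<open>p = CARD('p)\<close> and \<open>q = CARD('q)\<close>.
\<close>

type_synonym ('p, 'q) pt = "(real ^ 'p) \<times> (real ^ 'p) \<times> (real ^ 'p) \<times> (real ^ 'q)"

text \<open>
  On vectors, \<open>\<le>\<close> is the entrywise order and \<open>1\<close> is the all-ones vector;
  the \<open>i\<close>th column of the identity matrix is \<open>axis i 1\<close>.
\<close>

definition P_poly :: "('q::finite \<Rightarrow> 'p::finite clause) \<Rightarrow> ('p, 'q) pt set" where
  "P_poly c = {(s, t, u, v).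
      0 \<le> s \<and> s \<le> u \<and> 0 \<le> t \<and> t \<le> u \<and> 0 \<le> u \<and> u \<le> 1 \<and> 0 \<le> v \<and>
      (\<forall>i j. Neg i \<in> set (c j) \<longrightarrow> s $ i - 2 * t $ i \<le> v $ j) \<and>
      (\<forall>i j. Pos i \<in> set (c j) \<longrightarrow> 2 * t $ i - 2 * s $ i - u $ i \<le> v $ j)}"

definition S_pts :: "('p::finite, 'q::finite) pt set" where
  "S_pts =
     (let p = real CARD('p) in
      {(0, 0, 0, 0),
       ((1 / (4 * p)) *\<^sub>R 1, (1 / (4 * p)) *\<^sub>R 1, (1 / (2 * p)) *\<^sub>R 1, (2.5 / (8 * p)) *\<^sub>R 1)}
      \<union> {(0, 0, 0, axis j 1) | j. True}
      \<union> {(0, (1/4) *\<^sub>R axis i 1, (1/2) *\<^sub>R axis i 1, 1) | i. True}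
      \<union> {((1/2) *\<^sub>R axis i 1, (1/4) *\<^sub>R axis i 1, (1/2) *\<^sub>R axis i 1, 1) | i. True}
      \<union> {((1/4) *\<^sub>R axis i 1, (1/8) *\<^sub>R axis i 1, (1/2) *\<^sub>R axis i 1, 1) | i. True}
      \<union> {((1/4) *\<^sub>R axis i 1, (3/8) *\<^sub>R axis i 1, (1/2) *\<^sub>R axis i 1, 1) | i. True})"

end

theory Submission
  imports Defs
begin

text \<open>
  Given an assignment, take as vertices \<open>0\<close>, multiples of the unit vectors in the \<open>v\<close> space, and for
  each variable three points over \<open>u = e\<^sub>i\<close> whose \<open>(s, t)\<close> parts form one of the two triangles
  that fit in the gadget of that variable, with the least \<open>v\<close> that \<open>P\<close> permits. A clause with at most
  two false literals needs at most \<open>2/(8p)\<close> in its \<open>v\<close> coordinate at the second point of \<open>S\<close>, which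
  has \<open>2.5/(8p)\<close> there.

  Conversely, all points of \<open>S\<close> other than the second lie on faces of \<open>P\<close> on which at most one
  coordinate of \<open>u\<close> is nonzero, so the vertices of \<open>T\<close> on these faces already span the space. Since \<open>T\<close>
  has only \<open>3p + q + 1\<close> vertices, every vertex lies on such a face, and at most three have \<open>u\<^sub>i > 0\<close>
  for a given \<open>i\<close>. Up to scaling, these form one of the two triangles, which defines an assignment, and
  every false literal of a clause contributes at least \<open>1/(8p)\<close> to its \<open>v\<close> coordinate at the second point.
\<close>

section \<open>Triangles in the unit square around the four gadget points\<close>

lemma weighted_sum_eq_0D:
  fixes f \<mu> :: "'a \<Rightarrow> real"
  assumes "finite G" "\<And>w. w \<in> G \<Longrightarrow> 0 \<le> \<mu> w" "\<And>w. w \<in> G \<Longrightarrow> 0 \<le> f w"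
    "(\<Sum>w\<in>G. \<mu> w * f w) = 0" "w \<in> G"
  shows "\<mu> w = 0 \<or> f w = 0"
  using sum_nonneg_0[of G "\<lambda>w. \<mu> w * f w" w] assms by auto

lemma weighted_sum_neq_0D:
  fixes f \<mu> :: "'a \<Rightarrow> real"
  assumes "(\<Sum>w\<in>G. \<mu> w * f w) \<noteq> 0"
  shows "\<exists>w\<in>G. \<mu> w \<noteq> 0"
  using assms by (metis (no_types, lifting) mult_zero_left sum.neutral)

text \<open>In the coordinates \<open>(s/u, t/u)\<close> the weights \<alpha>, \<beta>, \<gamma>,
  \<delta> express the points \<open>(0,1/2)\<close>, \<open>(1,1/2)\<close>,
  \<open>(1/2,1/4)\<close>, \<open>(1/2,3/4)\<close>. The first lies on the edge
  \<open>s = 0\<close>, hence is \<open>x\<close> itself. All other vertices turn out to lie on the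
  edge \<open>s = u\<close>, and the last two points then force vertices at the two ends of that
  edge.\<close>

lemma triangle_vertices_if_unique_left:
  fixes s t u :: "'a \<Rightarrow> real"
  assumes fin: "finite G" and card: "card G \<le> 3"
    and s: "\<And>w. w \<in> G \<Longrightarrow> 0 \<le> s w \<and> s w \<le> u w"
    and t: "\<And>w. w \<in> G \<Longrightarrow> 0 \<le> t w \<and> t w \<le> u w"
    and u: "\<And>w. w \<in> G \<Longrightarrow> 0 < u w"
    and nn: "\<And>w. w \<in> G \<Longrightarrow> 0 \<le> \<alpha> w \<and> 0 \<le> \<beta> w \<and> 0 \<le> \<gamma> w \<and> 0 \<le> \<delta> w"
    and \<alpha>: "(\<Sum>w\<in>G. \<alpha> w * s w) = 0" "(\<Sum>w\<in>G. \<alpha> w * t w) = 1/4" "(\<Sum>w\<in>G. \<alpha> w * u w) = 1/2"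
    and \<beta>: "(\<Sum>w\<in>G. \<beta> w * s w) = 1/2" "(\<Sum>w\<in>G. \<beta> w * t w) = 1/4" "(\<Sum>w\<in>G. \<beta> w * u w) = 1/2"
    and \<gamma>: "(\<Sum>w\<in>G. \<gamma> w * s w) = 1/4" "(\<Sum>w\<in>G. \<gamma> w * t w) = 1/8" "(\<Sum>w\<in>G. \<gamma> w * u w) = 1/2"
    and \<delta>: "(\<Sum>w\<in>G. \<delta> w * s w) = 1/4" "(\<Sum>w\<in>G. \<delta> w * t w) = 3/8" "(\<Sum>w\<in>G. \<delta> w * u w) = 1/2"
    and x: "x \<in> G" "s x = 0" and only: "\<And>w. w \<in> G \<Longrightarrow> s w = 0 \<Longrightarrow> w = x"
  shows "\<exists>y z. G = {x, y, z} \<and> x \<noteq> y \<and> x \<noteq> z \<and> y \<noteq> z \<and> 2 * t x = u x \<and>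
    s y = u y \<and> t y = 0 \<and> s z = u z \<and> t z = u z"
proof -
  have split: "(\<Sum>w\<in>G. f w) = f x + (\<Sum>w\<in>G-{x}. f w)" for f :: "'a \<Rightarrow> real"
    using fin x(1) by (rule sum.remove)
  have ux: "0 < u x" using u x by blast
  have \<alpha>0: "\<alpha> w = 0" if "w \<in> G - {x}" for w
    using weighted_sum_eq_0D[of G \<alpha> s w] fin nn s \<alpha>(1) only that by blast
  have "\<alpha> x * t x = 1/4" "\<alpha> x * u x = 1/2"
    using \<alpha>(2,3) \<alpha>0 by (simp_all add: split)
  then have "\<alpha> x * (2 * t x - u x) = 0"
    by (simp only: right_diff_distrib mult.left_commute[of _ 2])
  moreover have "\<alpha> x \<noteq> 0" using \<open>\<alpha> x * u x = 1/2\<close> by auto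
  ultimately have tx: "2 * t x = u x" by simp
  have "(\<Sum>w\<in>G. \<beta> w * (u w - s w)) = 0"
    using \<beta> by (simp add: right_diff_distrib sum_subtractf)
  then have \<beta>0: "\<beta> w = 0" if "w \<in> G" "s w \<noteq> u w" for w
    using weighted_sum_eq_0D[of G \<beta> "\<lambda>w. u w - s w" w] fin nn s that by auto
  \<comment> \<open>If \<open>z\<close> is off the edge \<open>s = u\<close>, only one vertex
    \<open>y\<close> remains for that edge, so \<open>y\<close> is the point \<open>(1,1/2)\<close>.
    Then \<open>2 * t - u\<close> vanishes at \<open>x\<close> and \<open>y\<close>, while \<gamma>
    and \<delta> require it to be negative and positive at \<open>z\<close>.\<close>
  have all: "s z = u z" if z: "z \<in> G - {x}" for z
  proof (rule ccontr)
    assume zu: "s z \<noteq> u z"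
    have "card (G - {x} - {z}) \<le> 1" using card fin x z by simp
    moreover have "\<exists>y\<in>G. \<beta> y \<noteq> 0"
      by (rule weighted_sum_neq_0D[where f = u]) (simp add: \<beta>(3))
    then obtain y where y: "y \<in> G" "\<beta> y \<noteq> 0" by blast
    then have ys: "s y = u y" "y \<noteq> z" "y \<noteq> x" using \<beta>0 zu x ux by auto
    ultimately have yz: "G - {x} - {z} = {y}"
      using y fin card_seteq[of "G - {x} - {z}" "{y}"] by simp
    then have Gx: "G - {x} = {y, z}" using z by auto
    have sp: "(\<Sum>w\<in>G. f w) = f x + f y + f z" for f :: "'a \<Rightarrow> real"
      using ys by (simp add: split Gx)
    have "\<beta> x = 0" "\<beta> z = 0" using \<beta>0 zu z x ux by auto
    then have "\<beta> y * t y = 1/4" "\<beta> y * u y = 1/2" using \<beta> by (simp_all add: sp)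
    then have "\<beta> y * (2 * t y - u y) = 0"
      by (simp only: right_diff_distrib mult.left_commute[of _ 2])
    then have ty: "2 * t y = u y" using y by simp
    have "\<gamma> z * (2 * t z - u z) = -1/4"
    proof -
      have "(\<Sum>w\<in>G. \<gamma> w * (2 * t w - u w)) = -1/4"
        using \<gamma> by (simp add: right_diff_distrib sum_subtractf mult.left_commute[of _ 2] flip: sum_distrib_left)
      then show ?thesis using tx ty by (simp add: sp)
    qed
    moreover have "\<delta> z * (2 * t z - u z) = 1/4"
    proof -
      have "(\<Sum>w\<in>G. \<delta> w * (2 * t w - u w)) = 1/4"
        using \<delta> by (simp add: right_diff_distrib sum_subtractf mult.left_commute[of _ 2] flip: sum_distrib_left)
      then show ?thesis using tx ty by (simp add: sp)
    qed
    moreover have "0 \<le> \<gamma> z" "0 \<le> \<delta> z" using nn z by auto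
    ultimately show False
      by (smt (verit) mult_nonneg_nonneg mult_nonneg_nonpos divide_pos_pos divide_neg_pos)
  qed
  \<comment> \<open>Stated for a general \<open>f\<close> so that it serves both \<open>t\<close>
    with \<gamma> and \<open>u - t\<close> with \<delta>. Since all other vertices have
    \<open>s = u\<close>, they carry half of the weighted \<open>u\<close>-sum and \<open>x\<close>
    the other half; the term at \<open>x\<close> then uses up the whole sum of
    \<open>f\<close>.\<close>
  have opp: "\<exists>y\<in>G-{x}. f y = 0"
    if "\<And>w. w \<in> G \<Longrightarrow> 0 \<le> f w" "\<And>w. w \<in> G \<Longrightarrow> 0 \<le> \<epsilon> w" "2 * f x = u x"
      "(\<Sum>w\<in>G. \<epsilon> w * s w) = 1/4" "(\<Sum>w\<in>G. \<epsilon> w * f w) = 1/8" "(\<Sum>w\<in>G. \<epsilon> w * u w) = 1/2"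
    for f \<epsilon> :: "'a \<Rightarrow> real"
  proof -
    have A: "(\<Sum>w\<in>G-{x}. \<epsilon> w * u w) = 1/4"
    proof -
      have "(\<Sum>w\<in>G-{x}. \<epsilon> w * u w) = (\<Sum>w\<in>G-{x}. \<epsilon> w * s w)"
        by (intro sum.cong) (simp_all add: all)
      then show ?thesis using that(4) x by (simp add: split)
    qed
    then have "\<epsilon> x * u x = 1/4" using that(6) by (simp add: split)
    then have "\<epsilon> x * f x = 1/8" using that(3)[symmetric] by simp
    then have "(\<Sum>w\<in>G-{x}. \<epsilon> w * f w) = 0" using that(5) by (simp add: split)
    then have "\<forall>w\<in>G-{x}. \<epsilon> w = 0 \<or> f w = 0"
      using weighted_sum_eq_0D[of "G-{x}" \<epsilon> f] that(1,2) fin by auto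
    moreover have "\<exists>y\<in>G-{x}. \<epsilon> y \<noteq> 0"
      by (rule weighted_sum_neq_0D[where f = u]) (simp add: A)
    ultimately show ?thesis by auto
  qed
  obtain y where y: "y \<in> G - {x}" "t y = 0"
    using opp[of t \<gamma>] t nn tx \<gamma> by blast
  have "(\<Sum>w\<in>G. \<delta> w * (u w - t w)) = 1/8"
    using \<delta> by (simp add: right_diff_distrib sum_subtractf)
  moreover have "2 * (u x - t x) = u x" using tx by simp
  ultimately obtain z where z: "z \<in> G - {x}" "u z - t z = 0"
    using opp[of "\<lambda>w. u w - t w" \<delta>] t nn \<delta> by auto
  have yz: "y \<noteq> z" using y z u by force
  have "G = {x, y, z}"
    using card_seteq[of G "{x,y,z}"] fin card x y z yz by auto
  with y z yz tx all show ?thesis by (intro exI[of _ y] exI[of _ z]) auto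
qed

text \<open>
  In the coordinates \<open>(s/u, t/u)\<close>, a triangle in the unit square that contains the four points
  has the vertices \<open>(0,1/2), (1,0), (1,1)\<close> or \<open>(1,1/2), (0,0), (0,1)\<close>.
  The vertex \<open>(1,0)\<close>, respectively \<open>(0,1)\<close>, yields the stated lower bound.
\<close>

lemma triangle_dichotomy:
  fixes s t u \<kappa> :: "'a \<Rightarrow> real"
  assumes fin: "finite G" and card: "card G \<le> 3"
    and s: "\<And>w. w \<in> G \<Longrightarrow> 0 \<le> s w \<and> s w \<le> u w"
    and t: "\<And>w. w \<in> G \<Longrightarrow> 0 \<le> t w \<and> t w \<le> u w"
    and u: "\<And>w. w \<in> G \<Longrightarrow> 0 < u w"
    and pts: "\<And>a b. (a, b) \<in> {(0, 1/4), (1/2, 1/4), (1/4, 1/8), (1/4, 3/8)} \<Longrightarrow>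
      \<exists>\<mu>. (\<forall>w\<in>G. 0 \<le> \<mu> w) \<and> (\<Sum>w\<in>G. \<mu> w * s w) = a \<and> (\<Sum>w\<in>G. \<mu> w * t w) = b \<and>
        (\<Sum>w\<in>G. \<mu> w * u w) = 1/2"
    and \<kappa>: "\<And>w. w \<in> G \<Longrightarrow> 0 \<le> \<kappa> w" "(\<Sum>w\<in>G. \<kappa> w * s w) = h" "(\<Sum>w\<in>G. \<kappa> w * t w) = h"
      "(\<Sum>w\<in>G. \<kappa> w * u w) = 2 * h"
  shows "h / 2 \<le> (\<Sum>w\<in>G. \<kappa> w * max 0 (s w - 2 * t w)) \<or>
    h / 2 \<le> (\<Sum>w\<in>G. \<kappa> w * max 0 (2 * t w - 2 * s w - u w))"
proof -
  obtain \<alpha> where \<alpha>: "\<forall>w\<in>G. 0 \<le> \<alpha> w" "(\<Sum>w\<in>G. \<alpha> w * s w) = 0" "(\<Sum>w\<in>G. \<alpha> w * t w) = 1/4" "(\<Sum>w\<in>G. \<alpha> w * u w) = 1/2"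
    using pts[of 0 "1/4"] by auto
  obtain \<beta> where \<beta>: "\<forall>w\<in>G. 0 \<le> \<beta> w" "(\<Sum>w\<in>G. \<beta> w * s w) = 1/2" "(\<Sum>w\<in>G. \<beta> w * t w) = 1/4" "(\<Sum>w\<in>G. \<beta> w * u w) = 1/2"
    using pts[of "1/2" "1/4"] by auto
  obtain \<gamma> where \<gamma>: "\<forall>w\<in>G. 0 \<le> \<gamma> w" "(\<Sum>w\<in>G. \<gamma> w * s w) = 1/4" "(\<Sum>w\<in>G. \<gamma> w * t w) = 1/8" "(\<Sum>w\<in>G. \<gamma> w * u w) = 1/2"
    using pts[of "1/4" "1/8"] by auto
  obtain \<delta> where \<delta>: "\<forall>w\<in>G. 0 \<le> \<delta> w" "(\<Sum>w\<in>G. \<delta> w * s w) = 1/4" "(\<Sum>w\<in>G. \<delta> w * t w) = 3/8" "(\<Sum>w\<in>G. \<delta> w * u w) = 1/2"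
    using pts[of "1/4" "3/8"] by auto
  have ex: "\<exists>x\<in>G. f x = 0" if "(\<Sum>w\<in>G. \<mu> w * f w) = 0" "(\<Sum>w\<in>G. \<mu> w * u w) = 1/2"
    "\<And>w. w \<in> G \<Longrightarrow> 0 \<le> f w" "\<forall>w\<in>G. 0 \<le> \<mu> w" for f \<mu> :: "'a \<Rightarrow> real"
  proof -
    have "\<forall>w\<in>G. \<mu> w = 0 \<or> f w = 0"
      using weighted_sum_eq_0D[of G \<mu> f] that(1,3,4) fin by blast
    moreover have "\<exists>y\<in>G. \<mu> y \<noteq> 0"
      by (rule weighted_sum_neq_0D[where f = u]) (simp add: that(2))
    ultimately show ?thesis by auto
  qed
  have refl: "(\<Sum>w\<in>G. \<mu> w * (u w - s w)) = (\<Sum>w\<in>G. \<mu> w * u w) - (\<Sum>w\<in>G. \<mu> w * s w)" for \<mu>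
    by (simp add: right_diff_distrib sum_subtractf)
  obtain x where x: "x \<in> G" "s x = 0"
    using ex[of \<alpha> s] \<alpha> s by blast
  obtain x' where x': "x' \<in> G" "u x' - s x' = 0"
    using ex[of \<beta> "\<lambda>w. u w - s w"] \<beta> s refl by auto
  \<comment> \<open>One of the edges \<open>s = 0\<close> and \<open>s = u\<close> carries a single
    vertex: they are disjoint because \<open>u > 0\<close>, so two vertices on each would make
    four.\<close>
  consider "\<And>w. w \<in> G \<Longrightarrow> s w = 0 \<Longrightarrow> w = x" | "\<And>w. w \<in> G \<Longrightarrow> u w - s w = 0 \<Longrightarrow> w = x'"
  proof -
    have False if a: "a \<in> G" "s a = 0" "a \<noteq> x" and b: "b \<in> G" "u b - s b = 0" "b \<noteq> x'" for a b
    proof -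
      have "a \<noteq> b" "a \<noteq> x'" "x \<noteq> b" "x \<noteq> x'" using u x x' a b by force+
      then have "card {a, b, x, x'} = 4" using a b by auto
      moreover have "card {a, b, x, x'} \<le> card G" using a b x x' fin by (intro card_mono) auto
      ultimately show False using card by simp
    qed
    then show thesis using that by metis
  qed
  then show ?thesis
  proof cases
    case 1
    have "\<exists>y z. G = {x, y, z} \<and> x \<noteq> y \<and> x \<noteq> z \<and> y \<noteq> z \<and> 2 * t x = u x \<and>
      s y = u y \<and> t y = 0 \<and> s z = u z \<and> t z = u z"
      using \<alpha>(1) \<beta>(1) \<gamma>(1) \<delta>(1)
      by (intro triangle_vertices_if_unique_left[OF fin card s t u _ \<alpha>(2-4) \<beta>(2-4) \<gamma>(2-4) \<delta>(2-4) x 1]) simp_all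
    then obtain y z where yz: "G = {x, y, z}" "x \<noteq> y" "x \<noteq> z" "y \<noteq> z" "2 * t x = u x"
      "s y = u y" "t y = 0" "s z = u z" "t z = u z" by auto
    \<comment> \<open>The point given by \<kappa> is the centre of the square, and its weights on
      \<open>(0,1/2)\<close>, \<open>(1,0)\<close>, \<open>(1,1)\<close> are in the ratio 2 : 1 : 1.
      At \<open>y\<close> the value of \<open>s - 2 * t\<close> is \<open>u\<close>.\<close>
    have "\<kappa> y * u y = h / 2"
    proof -
      have sum3: "(\<Sum>w\<in>G. f w) = f x + f y + f z" for f :: "'a \<Rightarrow> real"
        using yz(2-4) by (simp add: yz(1))
      have "\<kappa> x * u x = 2 * (\<kappa> x * t x)" unfolding yz(5)[symmetric] by simp
      moreover have  "s x = 0" using x by simp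
      ultimately show ?thesis using \<kappa>(2-4) unfolding sum3 yz(6-9) by (simp only:)
    qed
    then have "h / 2 \<le> (\<Sum>w\<in>{y}. \<kappa> w * max 0 (s w - 2 * t w))"
      using yz(6,7) u[of y] yz(1) by simp
    also have "\<dots> \<le> (\<Sum>w\<in>G. \<kappa> w * max 0 (s w - 2 * t w))"
      using fin \<kappa>(1) yz(1) by (intro sum_mono2) auto
    finally show ?thesis by simp
  next
    case 2
    \<comment> \<open>The reflection \<open>s\<close> to \<open>u - s\<close> swaps the points of
      \<alpha> and \<beta> and fixes those of \<gamma> and \<delta>, so this case reduces to the
      previous one.\<close>
    have "\<exists>y z. G = {x', y, z} \<and> x' \<noteq> y \<and> x' \<noteq> z \<and> y \<noteq> z \<and> 2 * t x' = u x' \<and>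
      u y - s y = u y \<and> t y = 0 \<and> u z - s z = u z \<and> t z = u z"
    proof (rule triangle_vertices_if_unique_left[where \<alpha> = \<beta> and \<beta> = \<alpha> and \<gamma> = \<gamma> and \<delta> = \<delta>])
      show "\<And>w. w \<in> G \<Longrightarrow> 0 \<le> u w - s w \<and> u w - s w \<le> u w" using s by auto
      show "w = x'" if "w \<in> G" "u w - s w = 0" for w using that 2 by blast
    qed (use fin card t u \<alpha> \<beta> \<gamma> \<delta> x' refl in auto)
    then obtain y z where yz: "G = {x', y, z}" "x' \<noteq> y" "x' \<noteq> z" "y \<noteq> z" "2 * t x' = u x'"
      "s y = 0" "t y = 0" "s z = 0" "t z = u z" by auto
    have "\<kappa> z * u z = h / 2"
    proof -
      have sum3: "(\<Sum>w\<in>G. f w) = f x' + f y + f z" for f :: "'a \<Rightarrow> real"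
        using yz(2-4) by (simp add: yz(1))
      have "\<kappa> x' * u x' = 2 * (\<kappa> x' * t x')" unfolding yz(5)[symmetric] by simp
      moreover have  "s x' = u x'" using x' by simp
      ultimately show ?thesis using \<kappa>(2-4) unfolding sum3 yz(6-9) by (simp only:)
    qed
    then have "h / 2 \<le> (\<Sum>w\<in>{z}. \<kappa> w * max 0 (2 * t w - 2 * s w - u w))"
      using yz(8,9) u[of z] yz(1) by simp
    also have "\<dots> \<le> (\<Sum>w\<in>G. \<kappa> w * max 0 (2 * t w - 2 * s w - u w))"
      using fin \<kappa>(1) yz(1) by (intro sum_mono2) auto
    finally show ?thesis by simp
  qed
qed

section \<open>Coordinates and convexity of the polyhedron\<close>

abbreviation sc :: "('p, 'q) pt \<Rightarrow> real ^ 'p" where "sc w \<equiv> fst w"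
abbreviation tc :: "('p, 'q) pt \<Rightarrow> real ^ 'p" where "tc w \<equiv> fst (snd w)"
abbreviation uc :: "('p, 'q) pt \<Rightarrow> real ^ 'p" where "uc w \<equiv> fst (snd (snd w))"
abbreviation vc :: "('p, 'q) pt \<Rightarrow> real ^ 'q" where "vc w \<equiv> snd (snd (snd w))"

lemma mem_P_poly:
  "w \<in> P_poly c \<longleftrightarrow>
    (\<forall>i. 0 \<le> sc w $ i \<and> sc w $ i \<le> uc w $ i \<and> 0 \<le> tc w $ i \<and> tc w $ i \<le> uc w $ i \<and>
      uc w $ i \<le> 1) \<and> (\<forall>j. 0 \<le> vc w $ j) \<and>
    (\<forall>i j. Neg i \<in> set (c j) \<longrightarrow> sc w $ i - 2 * tc w $ i \<le> vc w $ j) \<and>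
    (\<forall>i j. Pos i \<in> set (c j) \<longrightarrow> 2 * tc w $ i - 2 * sc w $ i - uc w $ i \<le> vc w $ j)"
  unfolding P_poly_def by (cases w) (auto simp: less_eq_vec_def intro: order_trans)

lemma convex_P_poly: "convex (P_poly c)"
proof (rule convexI)
  fix x y :: "('a, 'b) pt" and a b :: real
  assume xy: "x \<in> P_poly c" "y \<in> P_poly c" and ab: "0 \<le> a" "0 \<le> b" "a + b = 1"
  \<comment> \<open>Each constraint compares two linear or constant expressions, so each one is an
    instance of this inequality.\<close>
  have comb: "a * l + b * m \<le> a * l' + b * m'" if "l \<le> l'" "m \<le> m'" for l m l' m'
    using that ab by (intro add_mono mult_left_mono)
  let ?z = "a *\<^sub>R x + b *\<^sub>R y"
  have "0 \<le> sc ?z $ i" "sc ?z $ i \<le> uc ?z $ i" "0 \<le> tc ?z $ i" "tc ?z $ i \<le> uc ?z $ i"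
    "uc ?z $ i \<le> 1" for i
    using xy comb[of 0 "sc x $ i" 0 "sc y $ i"] comb[of "sc x $ i" "uc x $ i" "sc y $ i" "uc y $ i"]
      comb[of 0 "tc x $ i" 0 "tc y $ i"] comb[of "tc x $ i" "uc x $ i" "tc y $ i" "uc y $ i"]
      comb[of "uc x $ i" 1 "uc y $ i" 1] ab
    by (auto simp: mem_P_poly)
  moreover have "0 \<le> vc ?z $ j" for j
    using xy comb[of 0 "vc x $ j" 0 "vc y $ j"] by (auto simp: mem_P_poly)
  moreover have "sc ?z $ i - 2 * tc ?z $ i \<le> vc ?z $ j" if "Neg i \<in> set (c j)" for i j
    using xy that
      comb[of "sc x $ i - 2 * tc x $ i" "vc x $ j" "sc y $ i - 2 * tc y $ i" "vc y $ j"]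
    by (auto simp: mem_P_poly algebra_simps)
  moreover have "2 * tc ?z $ i - 2 * sc ?z $ i - uc ?z $ i \<le> vc ?z $ j" if "Pos i \<in> set (c j)" for i j
    using xy that comb[of "2 * tc x $ i - 2 * sc x $ i - uc x $ i" "vc x $ j"
        "2 * tc y $ i - 2 * sc y $ i - uc y $ i" "vc y $ j"]
    by (auto simp: mem_P_poly algebra_simps)
  ultimately show "?z \<in> P_poly c" unfolding mem_P_poly by blast
qed

section \<open>The points of \<open>S_pts\<close>\<close>

text \<open>Divided by \<open>u = 1/2\<close>, these are the midpoints of the left and right sides
  of the unit square and the points \<open>(1/2,1/4)\<close> and \<open>(1/2,3/4)\<close>.\<close>

definition gadget_coords :: "(real \<times> real) set" where
  "gadget_coords = {(0, 1/4), (1/2, 1/4), (1/4, 1/8), (1/4, 3/8)}"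

definition gadget_pt :: "real \<Rightarrow> real \<Rightarrow> 'p \<Rightarrow> ('p::finite, 'q::finite) pt" where
  "gadget_pt a b i = (a *\<^sub>R axis i 1, b *\<^sub>R axis i 1, (1/2) *\<^sub>R axis i 1, 1)"

text \<open>For every variable at once, \<open>(s/u, t/u)\<close> is the centre of the unit
  square.\<close>

definition centre_pt :: "('p::finite, 'q::finite) pt" where
  "centre_pt = ((1 / (4 * real CARD('p))) *\<^sub>R 1, (1 / (4 * real CARD('p))) *\<^sub>R 1,
     (1 / (2 * real CARD('p))) *\<^sub>R 1, (2.5 / (8 * real CARD('p))) *\<^sub>R 1)"

lemma S_pts_eq:
  "S_pts = {0, centre_pt} \<union> {(0, 0, 0, axis j 1) | j. True} \<union>
    {gadget_pt a b i | a b i. (a, b) \<in> gadget_coords}"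
proof -
  have *: "{gadget_pt a b i | a b i. (a, b) \<in> gadget_coords} =
      {gadget_pt 0 (1/4) i | i. True} \<union> {gadget_pt (1/2) (1/4) i | i. True} \<union>
      {gadget_pt (1/4) (1/8) i | i. True} \<union> {gadget_pt (1/4) (3/8) i | i. True}"
    unfolding gadget_coords_def insert_iff prod.inject empty_iff by blast
  show ?thesis
    unfolding * unfolding S_pts_def gadget_pt_def centre_pt_def Let_def zero_prod_def
    by (simp only: Un_assoc scaleR_zero_left)
qed

lemma gadget_pt_in_S_pts: "(a, b) \<in> gadget_coords \<Longrightarrow> gadget_pt a b i \<in> S_pts"
  unfolding S_pts_eq by blast

section \<open>Faces of convex hulls and spanning sets\<close>

text \<open>The weighted values of \<open>g\<close> are nonnegative with sum 0, so every point with
  positive weight has \<open>g w = 0\<close>.\<close>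

lemma convex_hull_face:
  fixes g :: "'a::real_vector \<Rightarrow> real"
  assumes g: "linear g" and fin: "finite C" and nn: "\<And>w. w \<in> C \<Longrightarrow> 0 \<le> g w"
    and x: "x \<in> convex hull C" "g x = 0"
  shows "x \<in> convex hull {w \<in> C. g w = 0}"
proof -
  obtain \<mu> where \<mu>: "\<forall>w\<in>C. 0 \<le> \<mu> w" "sum \<mu> C = 1" "(\<Sum>w\<in>C. \<mu> w *\<^sub>R w) = x"
    using x(1) fin by (auto simp: convex_hull_finite)
  have "(\<Sum>w\<in>C. \<mu> w * g w) = 0"
    using x(2) \<mu>(3) by (auto simp: linear_sum[OF g] linear_scale[OF g])
  then have z: "\<mu> w = 0 \<or> g w = 0" if "w \<in> C" for w
    using weighted_sum_eq_0D[of C \<mu> g w] fin nn \<mu>(1) that by blast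
  have "sum \<mu> {w \<in> C. g w = 0} = 1"
    using \<mu>(2) z by (subst sum.mono_neutral_left[OF fin]) auto
  moreover have "(\<Sum>w | w \<in> C \<and> g w = 0. \<mu> w *\<^sub>R w) = x"
    unfolding \<mu>(3)[symmetric] using z by (intro sum.mono_neutral_left[OF fin]) auto
  ultimately show ?thesis
    using \<mu>(1) fin by (subst convex_hull_finite) auto
qed

lemma subspace_mem_v:
  fixes W :: "('p::finite, 'q::finite) pt set"
  assumes W: "subspace W" and v: "\<And>j. (0, 0, 0, axis j 1) \<in> W"
  shows "(0, 0, 0, v) \<in> W"
proof -
  have "(\<Sum>j\<in>UNIV. (v $ j) *\<^sub>R (0, 0, 0, axis j 1) :: ('p, 'q) pt) \<in> W"
    using v W by (intro subspace_sum subspace_scale)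
  also have "(\<Sum>j\<in>UNIV. (v $ j) *\<^sub>R (0, 0, 0, axis j 1) :: ('p, 'q) pt) = (0, 0, 0, v)"
    by (auto simp: prod_eq_iff fst_sum snd_sum vec_eq_iff axis_def if_distrib cong: if_cong)
  finally show ?thesis .
qed

text \<open>Collects the three directions of one variable, so that spanning can be checked variable
  by variable once the \<open>v\<close> directions are present.\<close>

definition axes_in :: "('p::finite, 'q::finite) pt set \<Rightarrow> 'p \<Rightarrow> bool" where
  "axes_in W i \<longleftrightarrow> (axis i 1, 0, 0, 0) \<in> W \<and> (0, axis i 1, 0, 0) \<in> W \<and> (0, 0, axis i 1, 0) \<in> W"

lemma subspace_eq_UNIV:
  fixes W :: "('p::finite, 'q::finite) pt set"
  assumes W: "subspace W" and v: "\<And>j. (0, 0, 0, axis j 1) \<in> W" and ax: "\<And>i. axes_in W i"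
  shows "W = UNIV"
proof -
  have "(s, t, u, v) \<in> W" for s t u v
  proof -
    have "(\<Sum>i\<in>UNIV. (s $ i) *\<^sub>R (axis i 1, 0, 0, 0) + (t $ i) *\<^sub>R (0, axis i 1, 0, 0) +
        (u $ i) *\<^sub>R (0, 0, axis i 1, 0) :: ('p, 'q) pt) + (0, 0, 0, v) \<in> W"
      using ax W subspace_mem_v[OF W v, of v] unfolding axes_in_def
      by (intro subspace_add subspace_sum subspace_scale) auto
    also have "(\<Sum>i\<in>UNIV. (s $ i) *\<^sub>R (axis i 1, 0, 0, 0) + (t $ i) *\<^sub>R (0, axis i 1, 0, 0) +
        (u $ i) *\<^sub>R (0, 0, axis i 1, 0) :: ('p, 'q) pt) + (0, 0, 0, v) = (s, t, u, v)"
      by (auto simp: prod_eq_iff fst_sum snd_sum vec_eq_iff axis_def if_distrib cong: if_cong)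
    finally show ?thesis .
  qed
  then show ?thesis by auto
qed

text \<open>Differences of gadget points give the \<open>s\<close> and \<open>t\<close> directions.
  Removing the \<open>t\<close> and \<open>v\<close> parts from one gadget point leaves the
  \<open>u\<close> direction.\<close>

lemma gadget_pts_axes_in:
  fixes W :: "('p::finite, 'q::finite) pt set"
  assumes W: "subspace W" and v: "\<And>j. (0, 0, 0, axis j 1) \<in> W"
    and g: "\<And>a b. (a, b) \<in> gadget_coords \<Longrightarrow> gadget_pt a b i \<in> W"
  shows "axes_in W i"
proof -
  note [simp] = gadget_pt_def gadget_coords_def
  have p: "gadget_pt 0 (1/4) i \<in> W" "gadget_pt (1/2) (1/4) i \<in> W"
    "gadget_pt (1/4) (1/8) i \<in> W" "gadget_pt (1/4) (3/8) i \<in> W"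
    using g by (auto simp del: gadget_pt_def)
  have "2 *\<^sub>R (gadget_pt (1/2) (1/4) i - gadget_pt 0 (1/4) i :: ('p, 'q) pt) \<in> W"
    using p W by (intro subspace_scale subspace_diff)
  then have s: "(axis i 1, 0, 0, 0) \<in> W" by (simp add: zero_prod_def)
  have "4 *\<^sub>R (gadget_pt (1/4) (3/8) i - gadget_pt (1/4) (1/8) i :: ('p, 'q) pt) \<in> W"
    using p W by (intro subspace_scale subspace_diff)
  then have t: "(0, axis i 1, 0, 0) \<in> W" by (simp add: zero_prod_def flip: scaleR_left.diff)
  have "2 *\<^sub>R (gadget_pt 0 (1/4) i - (1/4) *\<^sub>R (0, axis i 1, 0, 0) - (0, 0, 0, 1) :: ('p, 'q) pt) \<in> W"
    using p t W subspace_mem_v[OF W v] by (intro subspace_scale subspace_diff)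
  then have u: "(0, 0, axis i 1, 0) \<in> W" by (simp add: zero_prod_def)
  show ?thesis using s t u by (simp add: axes_in_def)
qed

section \<open>From an assignment to a simplex\<close>

text \<open>Affine independence of the vertices comes from counting: the nonzero ones span the space
  because their hull with 0 contains \<open>S_pts\<close>, and there are at most
  \<open>3p + q\<close> of them.\<close>

lemma satisfiable_imp_simplex:
  fixes c :: "'q::finite \<Rightarrow> 'p::finite clause"
  assumes "is_3sat c" "no_repeated_var c" "satisfiable c"
  shows "\<exists>T :: ('p, 'q) pt set.
       int (3 * CARD('p) + CARD('q)) simplex T \<and> S_pts \<subseteq> T \<and> T \<subseteq> P_poly c"
proof -
  obtain a where a: "\<And>j. \<exists>l\<in>set (c j). lit_true a l"
    using assms(3) unfolding satisfiable_def by blast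
  let ?p = "real CARD('p)" and ?q = "real CARD('q)"
  have pos: "?p > 0" "?q > 0" by (simp_all add: zero_less_card_finite)
  then have "1 \<le> ?p" by (simp add: Suc_leI)
  \<comment> \<open>Rewrites \<open>2 * (2.5 / (8 * p)) \<le> 2\<close>, which bounds the
    \<open>v\<close> part to be added at the centre point.\<close>
  then have p16: "5 \<le> ?p * 16" by linarith
  \<comment> \<open>\<open>F i\<close> is the literal on variable \<open>i\<close> that
    \<open>a\<close> makes false. Only at \<open>Y i\<close> do the clause constraints demand a
    positive \<open>v\<close>, namely 1 in the clauses containing \<open>F i\<close>.\<close>
  define F where "F i = (if a i then Neg i else Pos i)" for i
  define bad :: "'p \<Rightarrow> real ^ 'q" where "bad i = (\<chi> j. of_bool (F i \<in> set (c j)))" for i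
  \<comment> \<open>\<open>(s, t)\<close> runs over \<open>(0,1/2), (1,0), (1,1)\<close> if \<open>a i\<close> and over \<open>(1,1/2), (0,1), (0,0)\<close> otherwise.\<close>
  define \<sigma> :: "'p \<Rightarrow> real" where "\<sigma> i = of_bool (\<not> a i)" for i
  define X :: "'p \<Rightarrow> ('p, 'q) pt" where
    "X i = (\<sigma> i *\<^sub>R axis i 1, (1/2) *\<^sub>R axis i 1, axis i 1, 0)" for i
  define Y :: "'p \<Rightarrow> ('p, 'q) pt" where
    "Y i = ((1 - \<sigma> i) *\<^sub>R axis i 1, \<sigma> i *\<^sub>R axis i 1, axis i 1, bad i)" for i
  define Z :: "'p \<Rightarrow> ('p, 'q) pt" where
    "Z i = ((1 - \<sigma> i) *\<^sub>R axis i 1, (1 - \<sigma> i) *\<^sub>R axis i 1, axis i 1, 0)" for i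
  \<comment> \<open>The factor \<open>2 * q\<close> makes every \<open>v\<close> with entries in
    \<open>[0,2]\<close> reachable as an average over the \<open>q\<close> segments from 0 to
    \<open>V j\<close>.\<close>
  define V :: "'q \<Rightarrow> ('p, 'q) pt" where "V j = (0, 0, 0, (2 * ?q) *\<^sub>R axis j 1)" for j
  define B where "B = range X \<union> range Y \<union> range Z \<union> range V"
  define T where "T = convex hull (insert 0 B)"
  have bad01: "0 \<le> bad i $ j" "bad i $ j \<le> 1" for i j by (auto simp: bad_def)
  have bad2: "bad i $ j \<le> 2" for i j by (auto simp: bad_def)

  have "X i \<in> P_poly c" "Z i \<in> P_poly c" for i
    by (auto simp: mem_P_poly X_def Z_def \<sigma>_def axis_def)
  moreover have "Y i \<in> P_poly c" for i
    by (auto simp: mem_P_poly Y_def \<sigma>_def axis_def bad_def F_def)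
  moreover have "V j \<in> P_poly c" for j
    by (auto simp: mem_P_poly V_def axis_def)
  moreover have "0 \<in> P_poly c" by (auto simp: mem_P_poly)
  ultimately have TP: "T \<subseteq> P_poly c"
    unfolding T_def B_def by (intro hull_minimal convex_P_poly) auto

  have cT: "convex T" unfolding T_def by (rule convex_convex_hull)
  have inT: "X i \<in> T" "Y i \<in> T" "Z i \<in> T" "V j \<in> T" "0 \<in> T" for i j
    unfolding T_def B_def by (auto intro!: hull_inc)
  have half: "(1/2) *\<^sub>R (x + y) \<in> T" if "x \<in> T" "y \<in> T" for x y
    using convexD[OF cT that, of "1/2" "1/2"] by (simp add: scaleR_add_right)
  have vT: "(0, 0, 0, v) \<in> T" if v: "\<And>j. 0 \<le> v $ j \<and> v $ j \<le> 2" for v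
  proof -
    have "(1 - v $ j / 2) *\<^sub>R 0 + (v $ j / 2) *\<^sub>R V j \<in> T" for j
      using v[of j] inT cT by (intro convexD) auto
    then have "(\<Sum>j\<in>UNIV. (1 / ?q) *\<^sub>R ((v $ j / 2) *\<^sub>R V j)) \<in> T"
      using cT by (intro convex_sum) auto
    also have "(\<Sum>j\<in>UNIV. (1 / ?q) *\<^sub>R ((v $ j / 2) *\<^sub>R V j)) = (0, 0, 0, v)"
      by (auto simp: prod_eq_iff fst_sum snd_sum vec_eq_iff axis_def V_def if_distrib cong: if_cong)
    finally show ?thesis .
  qed
  \<comment> \<open>The midpoint of \<open>(s, t, u, v)\<close> and
    \<open>(0, 0, 0, 2r - v)\<close>: halving the first three parts leaves room to raise the last
    one to \<open>r\<close>.\<close>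
  have complete: "((1/2) *\<^sub>R s, (1/2) *\<^sub>R t, (1/2) *\<^sub>R u, r) \<in> T"
    if "(s, t, u, v) \<in> T" "\<And>j. v $ j \<le> 2 * r $ j" "\<And>j. 2 * r $ j \<le> v $ j + 2" for s t u v r
  proof -
    have "(0, 0, 0, 2 *\<^sub>R r - v) \<in> T" using that(2,3) by (intro vT) (auto simp: algebra_simps)
    from half[OF that(1) this] show ?thesis by simp
  qed

  have gp: "gadget_pt \<alpha> \<beta> i \<in> T"
    if w: "w \<in> T" "sc w = (2 * \<alpha>) *\<^sub>R axis i 1" "tc w = (2 * \<beta>) *\<^sub>R axis i 1" "uc w = axis i 1"
      "\<And>j. 0 \<le> vc w $ j" "\<And>j. vc w $ j \<le> 1" for w \<alpha> \<beta> i
  proof -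
    have "((2 * \<alpha>) *\<^sub>R axis i 1, (2 * \<beta>) *\<^sub>R axis i 1, axis i 1, vc w) \<in> T"
      using w(1-4) by (metis prod.collapse)
    from complete[OF this, of 1] show ?thesis
      using w(5,6) by (simp add: gadget_pt_def add_increasing order_trans[OF w(6)])
  qed
  have gadget: "gadget_pt \<alpha> \<beta> i \<in> T" if "(\<alpha>, \<beta>) \<in> gadget_coords" for \<alpha> \<beta> i
  proof -
    \<comment> \<open>In \<open>(s/u, t/u)\<close> coordinates one of the four points is
      \<open>X i\<close>, and the other three are the midpoints of the sides of the triangle
      \<open>X i\<close>, \<open>Y i\<close>, \<open>Z i\<close>.\<close>
    have "gadget_pt 0 (1/4) i \<in> T \<and> gadget_pt (1/2) (1/4) i \<in> T \<and>
        gadget_pt (1/4) (1/8) i \<in> T \<and> gadget_pt (1/4) (3/8) i \<in> T"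
    proof (cases "a i")
      case True
      then have \<sigma>: "\<sigma> i = 0" by (simp add: \<sigma>_def)
      have "gadget_pt 0 (1/4) i \<in> T"
        by (rule gp[OF inT(1)[of i]]) (auto simp: X_def Y_def Z_def \<sigma> bad01 bad2 vec_eq_iff)
      moreover have "gadget_pt (1/2) (1/4) i \<in> T"
        by (rule gp[OF half[OF inT(2)[of i] inT(3)[of i]]]) (auto simp: X_def Y_def Z_def \<sigma> bad01 bad2 vec_eq_iff)
      moreover have "gadget_pt (1/4) (1/8) i \<in> T"
        by (rule gp[OF half[OF inT(1)[of i] inT(2)[of i]]]) (auto simp: X_def Y_def Z_def \<sigma> bad01 bad2 vec_eq_iff)
      moreover have "gadget_pt (1/4) (3/8) i \<in> T"
        by (rule gp[OF half[OF inT(1)[of i] inT(3)[of i]]]) (auto simp: X_def Y_def Z_def \<sigma> bad01 bad2 vec_eq_iff)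
      ultimately show ?thesis by blast
    next
      case False
      then have \<sigma>: "\<sigma> i = 1" by (simp add: \<sigma>_def)
      have "gadget_pt 0 (1/4) i \<in> T"
        by (rule gp[OF half[OF inT(2)[of i] inT(3)[of i]]]) (auto simp: X_def Y_def Z_def \<sigma> bad01 bad2 vec_eq_iff)
      moreover have "gadget_pt (1/2) (1/4) i \<in> T"
        by (rule gp[OF inT(1)[of i]]) (auto simp: X_def Y_def Z_def \<sigma> bad01 bad2 vec_eq_iff)
      moreover have "gadget_pt (1/4) (1/8) i \<in> T"
        by (rule gp[OF half[OF inT(1)[of i] inT(3)[of i]]]) (auto simp: X_def Y_def Z_def \<sigma> bad01 bad2 vec_eq_iff)
      moreover have "gadget_pt (1/4) (3/8) i \<in> T"
        by (rule gp[OF half[OF inT(1)[of i] inT(2)[of i]]]) (auto simp: X_def Y_def Z_def \<sigma> bad01 bad2 vec_eq_iff)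
      ultimately show ?thesis by blast
    qed
    then show ?thesis
      using that unfolding gadget_coords_def insert_iff prod.inject empty_iff by blast
  qed

  have count: "(\<Sum>i\<in>UNIV. bad i $ j) \<le> 2" for j
  proof -
    have dist: "inj_on lit_var (set (c j))" "card (lit_var ` set (c j)) = 3"
      using assms(1,2) unfolding is_3sat_def no_repeated_var_def
      by (auto simp: distinct_map distinct_card card_image)
    obtain l where l: "l \<in> set (c j)" "lit_true a l" using a by blast
    have F: "lit_var (F i) = i" "\<not> lit_true a (F i)" for i by (auto simp: F_def)
    \<comment> \<open>The variable of the true literal \<open>l\<close> drops out: variables are
      distinct within a clause, so \<open>F i\<close> on that variable would be \<open>l\<close>,
      but \<open>F i\<close> is false.\<close>
    have "{i. F i \<in> set (c j)} \<subseteq> lit_var ` set (c j) - {lit_var l}"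
    proof
      fix i assume "i \<in> {i. F i \<in> set (c j)}"
      then have i: "F i \<in> set (c j)" by simp
      then have "i \<noteq> lit_var l" using inj_onD[OF dist(1), of "F i" l] l F by metis
      then show "i \<in> lit_var ` set (c j) - {lit_var l}" using i F(1)[of i] by (metis Diff_iff imageI singletonD)
    qed
    then have "card {i. F i \<in> set (c j)} \<le> card (lit_var ` set (c j) - {lit_var l})"
      by (intro card_mono) auto
    also have "\<dots> = 2" using l dist(2) by simp
    finally show ?thesis by (simp add: bad_def)
  qed
  have centre: "centre_pt \<in> T"
  proof -
    \<comment> \<open>Weights 1/2, 1/4, 1/4 produce the centre of the square with \<open>v\<close>
      part \<open>bad i / 4\<close>. Averaging over \<open>i\<close> and halving by
      \<open>complete\<close> yields the centre point.\<close>
    have "(1/2) *\<^sub>R (X i + (1/2) *\<^sub>R (Y i + Z i)) \<in> T" for i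
      by (intro half inT)
    moreover have "(1/2) *\<^sub>R (X i + (1/2) *\<^sub>R (Y i + Z i)) =
        ((1/2) *\<^sub>R axis i 1, (1/2) *\<^sub>R axis i 1, axis i 1, (1/4) *\<^sub>R bad i)" for i
      by (auto simp: X_def Y_def Z_def vec_eq_iff axis_def \<sigma>_def)
    ultimately have "((1/2) *\<^sub>R axis i 1, (1/2) *\<^sub>R axis i 1, axis i 1, (1/4) *\<^sub>R bad i) \<in> T" for i
      by metis
    then have "(\<Sum>i\<in>UNIV. (1 / ?p) *\<^sub>R ((1/2) *\<^sub>R axis i 1, (1/2) *\<^sub>R axis i 1, axis i 1, (1/4) *\<^sub>R bad i)) \<in> T"
      using cT by (intro convex_sum) auto
    also have "(\<Sum>i\<in>UNIV. (1 / ?p) *\<^sub>R ((1/2) *\<^sub>R axis i 1, (1/2) *\<^sub>R axis i 1, axis i 1, (1/4) *\<^sub>R bad i)) =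
        ((1 / (2 * ?p)) *\<^sub>R 1, (1 / (2 * ?p)) *\<^sub>R 1, (1 / ?p) *\<^sub>R 1, (1 / (4 * ?p)) *\<^sub>R (\<Sum>i\<in>UNIV. bad i))"
      by (auto simp: prod_eq_iff fst_sum snd_sum vec_eq_iff axis_def if_distrib mult.commute
          cong: if_cong simp flip: sum_divide_distrib)
    finally have m: "((1 / (2 * ?p)) *\<^sub>R 1, (1 / (2 * ?p)) *\<^sub>R 1, (1 / ?p) *\<^sub>R 1, (1 / (4 * ?p)) *\<^sub>R (\<Sum>i\<in>UNIV. bad i)) \<in> T" .
    have "((1 / (4 * ?p)) *\<^sub>R (\<Sum>i\<in>UNIV. bad i)) $ j \<le> 2 * ((2.5 / (8 * ?p)) *\<^sub>R 1) $ j" for j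
      using count[of j] pos by (simp add: field_simps)
    moreover have "2 * ((2.5 / (8 * ?p)) *\<^sub>R 1) $ j \<le> ((1 / (4 * ?p)) *\<^sub>R (\<Sum>i\<in>UNIV. bad i)) $ j + 2" for j
    proof -
      have "2 * ((2.5 / (8 * ?p)) *\<^sub>R 1 :: real ^ 'q) $ j \<le> 2"
        using pos p16 by (simp add: field_simps)
      moreover have "0 \<le> ((1 / (4 * ?p)) *\<^sub>R (\<Sum>i\<in>UNIV. bad i)) $ j"
        using pos bad01 by (auto intro!: sum_nonneg divide_nonneg_nonneg)
      ultimately show ?thesis by linarith
    qed
    ultimately show ?thesis using complete[OF m, of "(2.5 / (8 * ?p)) *\<^sub>R 1"]
      by (simp add: centre_pt_def)
  qed
  have axv: "(0, 0, 0, axis j 1) \<in> T" for j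
    by (intro vT) (auto simp: axis_def)
  have ST: "S_pts \<subseteq> T"
    unfolding S_pts_eq using inT(5) centre axv gadget by auto

  have "insert 0 B \<subseteq> span B" by (auto simp: span_base span_zero)
  then have Ts: "T \<subseteq> span B"
    unfolding T_def by (intro hull_minimal subspace_imp_convex subspace_span)
  have spanB: "span B = UNIV"
    using Ts axv gadget
    by (intro subspace_eq_UNIV gadget_pts_axes_in) (auto intro: subspace_span)
  have finB: "finite B" by (simp add: B_def)
  \<comment> \<open>An upper bound suffices: a spanning set with at most as many elements as the
    dimension is independent, which gives the exact cardinality.\<close>
  have "card B \<le> card (range X) + card (range Y) + card (range Z) + card (range V)"
    unfolding B_def by (meson add_le_mono1 card_Un_le le_trans)
  also have "\<dots> \<le> CARD('p) + CARD('p) + CARD('p) + CARD('q)"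
    by (intro add_mono card_image_le) auto
  finally have cardB: "card B \<le> DIM(('p, 'q) pt)" by simp
  have ind: "independent B"
    using card_le_dim_spanning[of B UNIV] finB spanB cardB by (simp add: dim_UNIV)
  have "card B = DIM(('p, 'q) pt)"
    using dim_span_eq_card_independent[OF ind] spanB by (simp add: dim_UNIV)
  moreover have "0 \<notin> B" using ind dependent_zero by blast
  ultimately have "int (card (insert 0 B)) = int (3 * CARD('p) + CARD('q)) + 1"
    using finB by simp
  moreover have "\<not> affine_dependent (insert 0 B)"
    using ind \<open>0 \<notin> B\<close> by (simp add: affine_dependent_iff_dependent)
  ultimately have "int (3 * CARD('p) + CARD('q)) simplex T"
    unfolding simplex_def T_def by blast
  with TP ST show ?thesis by blast
qed

section \<open>From a simplex to an assignment\<close>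

text \<open>The unit vectors in \<open>v\<close> lie on the face \<open>u = 0\<close>, and the
  gadget points of \<open>i\<close> on the face where only \<open>u $ i\<close> may be nonzero. Each
  is a combination of the vertices in \<open>C\<close> on its face, hence in \<open>W\<close>
  whenever those vertices are. The alternative \<open>axes_in W i\<close> allows the vertices of one
  variable to be traded for its three axes.\<close>

lemma span_eq_UNIV_of_faces:
  fixes C W :: "('p::finite, 'q::finite) pt set"
  assumes fin: "finite C" and CP: "C \<subseteq> P_poly c" and S: "S_pts \<subseteq> convex hull C"
    and W: "subspace W" and W0: "\<And>w. w \<in> C \<Longrightarrow> uc w = 0 \<Longrightarrow> w \<in> W"
    and Wi: "\<And>i. axes_in W i \<or> (\<forall>w\<in>C. (\<forall>k. k \<noteq> i \<longrightarrow> uc w $ k = 0) \<longrightarrow> w \<in> W)"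
  shows "W = UNIV"
proof -
  \<comment> \<open>The face is cut out by the sum of the \<open>u\<close> entries over
    \<open>K\<close>, which is nonnegative on \<open>C\<close>.\<close>
  have face: "x \<in> W" if x: "x \<in> S_pts" "\<And>k. k \<in> K \<Longrightarrow> uc x $ k = 0"
    and K: "\<And>w. w \<in> C \<Longrightarrow> \<forall>k\<in>K. uc w $ k = 0 \<Longrightarrow> w \<in> W" for x K
  proof -
    have nn: "0 \<le> uc w $ k" if "w \<in> C" for w k
      using that CP unfolding subset_iff mem_P_poly by (meson order_trans)
    have "x \<in> convex hull {w \<in> C. (\<Sum>k\<in>K. uc w $ k) = 0}"
    proof (rule convex_hull_face[OF _ fin])
      show "linear (\<lambda>w::('p, 'q) pt. \<Sum>k\<in>K. uc w $ k)"
        by (rule linearI) (simp_all add: sum.distrib sum_distrib_left)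
    qed (use x S nn in \<open>auto intro: sum_nonneg\<close>)
    also have "\<dots> \<subseteq> W"
      using K nn by (intro hull_minimal subspace_imp_convex[OF W]) (auto simp: sum_nonneg_eq_0_iff)
    finally show ?thesis .
  qed
  have v: "(0, 0, 0, axis j 1) \<in> W" for j
    by (rule face[of _ UNIV]) (auto simp: S_pts_eq vec_eq_iff intro!: W0)
  moreover have "axes_in W i" for i
  proof (cases "axes_in W i")
    case False
    then have w: "w \<in> W" if "w \<in> C" "\<forall>k. k \<noteq> i \<longrightarrow> uc w $ k = 0" for w
      using Wi that by blast
    have "gadget_pt a b i \<in> W" if "(a, b) \<in> gadget_coords" for a b
    proof (rule face[of _ "- {i}"])
      show "w \<in> W" if "w \<in> C" "\<forall>k\<in>- {i}. uc w $ k = 0" for w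
        using that by (intro w) auto
      show "gadget_pt a b i \<in> S_pts" using that by (rule gadget_pt_in_S_pts)
    qed (auto simp: gadget_pt_def axis_def)
    then show ?thesis using W v by (intro gadget_pts_axes_in)
  qed
  ultimately show ?thesis using W by (intro subspace_eq_UNIV)
qed

lemma simplex_imp_satisfiable:
  fixes c :: "'q::finite \<Rightarrow> 'p::finite clause" and T :: "('p, 'q) pt set"
  assumes "is_3sat c" "no_repeated_var c"
    and simp: "int (3 * CARD('p) + CARD('q)) simplex T" and ST: "S_pts \<subseteq> T" and TP: "T \<subseteq> P_poly c"
  shows "satisfiable c"
proof -
  let ?n = "3 * CARD('p) + CARD('q)"
  have dim: "DIM(('p, 'q) pt) = ?n" by simp
  obtain C where "int (card C) = int ?n + 1" and T: "T = convex hull C"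
    using simp unfolding simplex_def by blast
  then have card: "card C = ?n + 1" by linarith
  then have fin: "finite C" by (intro card_ge_0_finite) simp
  have CP: "C \<subseteq> P_poly c" using TP hull_subset[of C convex] T by blast
  have S: "S_pts \<subseteq> convex hull C" using ST T by simp
  have P: "0 \<le> sc w $ i" "sc w $ i \<le> uc w $ i" "0 \<le> tc w $ i" "tc w $ i \<le> uc w $ i"
    "0 \<le> uc w $ i" "0 \<le> vc w $ j" if "w \<in> C" for w i j
    using that CP unfolding subset_iff mem_P_poly by (blast intro: order_trans)+

  \<comment> \<open>The origin is the only point of \<open>P_poly c\<close> where the entries of
    \<open>u\<close> and \<open>v\<close> sum to 0, because \<open>s\<close> and \<open>t\<close>
    lie between 0 and \<open>u\<close>; so it must be a vertex.\<close>
  have "0 \<in> C"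
  proof -
    let ?g = "\<lambda>w::('p, 'q) pt. (\<Sum>i\<in>UNIV. uc w $ i) + (\<Sum>j\<in>UNIV. vc w $ j)"
    have "0 \<in> convex hull {w \<in> C. ?g w = 0}"
    proof (rule convex_hull_face[OF _ fin])
      show "linear ?g"
        by (rule linearI) (simp_all add: sum.distrib sum_distrib_left distrib_left)
      show "0 \<in> convex hull C" using S by (auto simp: S_pts_eq)
    qed (use P in \<open>auto intro!: add_nonneg_nonneg sum_nonneg\<close>)
    then obtain w where w: "w \<in> C" "?g w = 0" by (metis (mono_tags, lifting) convex_hull_empty empty_iff mem_Collect_eq ex_in_conv)
    then have "(\<Sum>i\<in>UNIV. uc w $ i) = 0" "(\<Sum>j\<in>UNIV. vc w $ j) = 0"
      using P by (smt (verit) sum_nonneg)+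
    then have uv: "uc w $ i = 0" "vc w $ j = 0" for i j
      using P[OF w(1)] by (simp_all add: sum_nonneg_eq_0_iff)
    then have "sc w $ i = 0" "tc w $ i = 0" for i
      using P(1-4)[OF w(1), of i] uv by (metis antisym)+
    with uv have "w = 0" by (simp add: prod_eq_iff vec_eq_iff)
    with w show ?thesis by simp
  qed

  \<comment> \<open>These vertices span the space, so at least \<open>3p + q\<close> of them are
    nonzero. Together with 0 this exhausts the \<open>3p + q + 1\<close> vertices in
    \<open>C\<close>.\<close>
  define D where "D = {w \<in> C. \<forall>k l. k \<noteq> l \<longrightarrow> uc w $ k = 0 \<or> uc w $ l = 0}"
  have "span (D - {0}) = UNIV"
  proof (rule span_eq_UNIV_of_faces[OF fin CP S subspace_span])
    have D: "w \<in> span (D - {0})" if "w \<in> D" for w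
      using that by (cases "w = 0") (auto intro: span_base span_zero)
    show "w \<in> span (D - {0})" if "w \<in> C" "uc w = 0" for w
      using that by (intro D) (simp add: D_def)
    show "axes_in (span (D - {0})) i \<or>
        (\<forall>w\<in>C. (\<forall>k. k \<noteq> i \<longrightarrow> uc w $ k = 0) \<longrightarrow> w \<in> span (D - {0}))" for i
    proof (intro disjI2 ballI impI D)
      fix w assume "w \<in> C" "\<forall>k. k \<noteq> i \<longrightarrow> uc w $ k = 0"
      then show "w \<in> D" unfolding D_def by (simp, metis)
    qed
  qed
  then have "?n \<le> card (D - {0})"
    using dim_le_card[of UNIV "D - {0}"] fin by (simp add: D_def dim_UNIV)
  moreover have "Suc (card (D - {0})) = card D"
    using \<open>0 \<in> C\<close> fin by (intro card_Suc_Diff1) (simp_all add: D_def)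
  ultimately have "card C \<le> card D" using card by linarith
  then have "D = C" using fin by (intro card_seteq) (auto simp: D_def)
  then have pure: "uc w $ k = 0 \<or> uc w $ l = 0" if "w \<in> C" "k \<noteq> l" for w k l
    using that unfolding D_def by blast

  define G where "G i = {w \<in> C. 0 < uc w $ i}" for i
  have finG: "finite (G i)" for i using fin by (simp add: G_def)
  have cardG: "card (G i) \<le> 3" for i
  proof -
    \<comment> \<open>Replacing the vertices in \<open>G i\<close> by the three axes of
      \<open>i\<close> keeps a spanning set. As \<open>E\<close> has
      \<open>3p + q - card (G i)\<close> elements, \<open>card (G i)\<close> is at most 3.\<close>
    define E where "E = C - G i - {0}"
    define A :: "('p, 'q) pt set" where "A = {(axis i 1, 0, 0, 0), (0, axis i 1, 0, 0), (0, 0, axis i 1, 0)}"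
    have "span (E \<union> A) = UNIV"
    proof (rule span_eq_UNIV_of_faces[OF fin CP S subspace_span])
      have E: "w \<in> span (E \<union> A)" if "w \<in> C" "uc w $ i = 0" for w
        using that by (cases "w = 0") (auto simp: E_def G_def intro: span_base span_zero)
      show "w \<in> span (E \<union> A)" if "w \<in> C" "uc w = 0" for w
        using that by (intro E) simp_all
      show "axes_in (span (E \<union> A)) k \<or>
          (\<forall>w\<in>C. (\<forall>l. l \<noteq> k \<longrightarrow> uc w $ l = 0) \<longrightarrow> w \<in> span (E \<union> A))" for k
      proof (cases "k = i")
        case True
        then show ?thesis by (simp add: axes_in_def A_def span_base)
      next
        case False
        then show ?thesis using E by (metis (no_types, lifting))
      qed
    qed
    then have "?n \<le> card (E \<union> A)"
      using dim_le_card[of UNIV "E \<union> A"] fin by (simp add: E_def A_def dim_UNIV)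
    also have "\<dots> \<le> card E + card A" by (rule card_Un_le)
    also have "card A \<le> 3" unfolding A_def by (simp add: card_insert_if)
    also have "card E = card C - card (G i) - 1"
      using \<open>0 \<in> C\<close> finG unfolding E_def by (subst card_Diff_singleton) (auto simp: G_def card_Diff_subset)
    moreover have "card (G i) < card C"
    proof (rule psubset_card_mono[OF fin])
      have "0 \<notin> G i" "G i \<subseteq> C" by (auto simp: G_def)
      then show "G i \<subset> C" using \<open>0 \<in> C\<close> by blast
    qed
    ultimately show ?thesis using card by linarith
  qed
  \<comment> \<open>The weights are those of a convex combination for \<open>x\<close>. For a
    coordinate between 0 and \<open>u $ i\<close>, only the vertices in \<open>G i\<close>
    contribute.\<close>
  have weights: "\<exists>\<mu>. (\<forall>w\<in>C. 0 \<le> \<mu> w) \<and>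
      (\<forall>i. (\<Sum>w\<in>G i. \<mu> w * sc w $ i) = sc x $ i \<and> (\<Sum>w\<in>G i. \<mu> w * tc w $ i) = tc x $ i \<and>
        (\<Sum>w\<in>G i. \<mu> w * uc w $ i) = uc x $ i) \<and> (\<forall>j. (\<Sum>w\<in>C. \<mu> w * vc w $ j) = vc x $ j)"
    if x: "x \<in> S_pts" for x
  proof -
    obtain \<mu> where \<mu>: "\<forall>w\<in>C. 0 \<le> \<mu> w" "(\<Sum>w\<in>C. \<mu> w *\<^sub>R w) = x"
      using x S fin by (auto simp: convex_hull_finite)
    have r: "(\<Sum>w\<in>G i. \<mu> w * f w) = (\<Sum>w\<in>C. \<mu> w * f w)"
      if "\<And>w. w \<in> C \<Longrightarrow> 0 \<le> f w \<and> f w \<le> uc w $ i" for f i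
    proof (rule sum.mono_neutral_left[OF fin])
      show "\<forall>w\<in>C - G i. \<mu> w * f w = 0"
      proof
        fix w assume "w \<in> C - G i"
        then have "f w = 0" using that[of w] P(5)[of w i] by (auto simp: G_def)
        then show "\<mu> w * f w = 0" by simp
      qed
    qed (auto simp: G_def)
    show ?thesis
      using \<mu>(1) P by (intro exI[of _ \<mu>]) (auto simp: r \<mu>(2)[symmetric] fst_sum snd_sum)
  qed

  let ?h = "1 / (4 * real CARD('p))"
  obtain \<kappa> where \<kappa>: "\<forall>w\<in>C. 0 \<le> \<kappa> w" "\<And>i. (\<Sum>w\<in>G i. \<kappa> w * sc w $ i) = ?h"
    "\<And>i. (\<Sum>w\<in>G i. \<kappa> w * tc w $ i) = ?h" "\<And>i. (\<Sum>w\<in>G i. \<kappa> w * uc w $ i) = 2 * ?h"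
    "\<And>j. (\<Sum>w\<in>C. \<kappa> w * vc w $ j) = 2.5 / (8 * real CARD('p))"
    using weights[of centre_pt] by (auto simp: S_pts_eq centre_pt_def)
  \<comment> \<open>If \<open>a i\<close> holds, a false literal \<open>Neg i\<close> adds at least
    \<open>?h / 2 = 1 / (8p)\<close> to its clause at the centre point. Otherwise the dichotomy of
    triangles gives the same bound for \<open>Pos i\<close>.\<close>
  define a where "a i \<longleftrightarrow> ?h / 2 \<le> (\<Sum>w\<in>G i. \<kappa> w * max 0 (sc w $ i - 2 * tc w $ i))" for i
  have na: "?h / 2 \<le> (\<Sum>w\<in>G i. \<kappa> w * max 0 (2 * tc w $ i - 2 * sc w $ i - uc w $ i))" if "\<not> a i" for i
  proof -
    have pts: "\<exists>\<mu>. (\<forall>w\<in>G i. 0 \<le> \<mu> w) \<and> (\<Sum>w\<in>G i. \<mu> w * sc w $ i) = \<alpha> \<and>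
        (\<Sum>w\<in>G i. \<mu> w * tc w $ i) = \<beta> \<and> (\<Sum>w\<in>G i. \<mu> w * uc w $ i) = 1/2"
      if "(\<alpha>, \<beta>) \<in> {(0, 1/4), (1/2, 1/4), (1/4, 1/8), (1/4, 3/8)}" for \<alpha> \<beta>
    proof -
      have "gadget_pt \<alpha> \<beta> i \<in> S_pts" using that by (intro gadget_pt_in_S_pts) (simp add: gadget_coords_def)
      from weights[OF this] obtain \<mu> where \<mu>: "\<forall>w\<in>C. 0 \<le> \<mu> w"
        "(\<Sum>w\<in>G i. \<mu> w * sc w $ i) = \<alpha>" "(\<Sum>w\<in>G i. \<mu> w * tc w $ i) = \<beta>"
        "(\<Sum>w\<in>G i. \<mu> w * uc w $ i) = 1/2" by (auto simp: gadget_pt_def)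
      then show ?thesis by (intro exI[of _ \<mu>]) (auto simp: G_def)
    qed
    have GC: "w \<in> C" "0 < uc w $ i" if "w \<in> G i" for w
      using that by (simp_all add: G_def)
    have "a i \<or> ?h / 2 \<le> (\<Sum>w\<in>G i. \<kappa> w * max 0 (2 * tc w $ i - 2 * sc w $ i - uc w $ i))"
      unfolding a_def
    proof (rule triangle_dichotomy[OF finG cardG _ _ _ pts _ \<kappa>(2-4)])
      fix w assume w: "w \<in> G i"
      show "0 \<le> sc w $ i \<and> sc w $ i \<le> uc w $ i" "0 \<le> tc w $ i \<and> tc w $ i \<le> uc w $ i"
        using P(1-4)[OF GC(1)[OF w]] by blast+
      show "0 < uc w $ i" by (rule GC(2)[OF w])
      show "0 \<le> \<kappa> w" using \<kappa>(1) GC(1)[OF w] by blast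
    qed
    with that show ?thesis by blast
  qed

  have "\<exists>l\<in>set (c j). lit_true a l" for j
  proof (rule ccontr)
    assume false: "\<not> ?thesis"
    define I where "I = lit_var ` set (c j)"
    have "card I = 3"
      using assms(1,2) unfolding is_3sat_def no_repeated_var_def I_def
      by (simp add: distinct_card flip: set_map)
    have "?h / 2 \<le> (\<Sum>w\<in>G i. \<kappa> w * vc w $ j)" if i: "i \<in> I" for i
    proof -
      have le: "(\<Sum>w\<in>G i. \<kappa> w * max 0 (f w)) \<le> (\<Sum>w\<in>G i. \<kappa> w * vc w $ j)"
        if "\<And>w. w \<in> P_poly c \<Longrightarrow> f w \<le> vc w $ j" for f
        using \<kappa>(1) CP P(6) that by (intro sum_mono mult_left_mono) (auto simp: G_def)
      obtain l where l: "l \<in> set (c j)" "lit_var l = i" "\<not> lit_true a l"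
        using i false unfolding I_def by blast
      show ?thesis
      proof (cases l)
        case (Pos k)
        with l have "Pos i \<in> set (c j)" "\<not> a i" by auto
        then show ?thesis
          by (intro order_trans[OF na le]) (auto simp: mem_P_poly)
      next
        case (Neg k)
        with l have "Neg i \<in> set (c j)" "a i" by auto
        then show ?thesis
          unfolding a_def by (elim order_trans, intro le) (auto simp: mem_P_poly)
      qed
    qed
    \<comment> \<open>The sets \<open>G i\<close> are disjoint since no vertex has two nonzero
      \<open>u\<close> entries. Three false literals therefore need \<open>3 / (8p)\<close>, more
      than the available \<open>2.5 / (8p)\<close>.\<close>
    then have "(\<Sum>i\<in>I. ?h / 2) \<le> (\<Sum>i\<in>I. \<Sum>w\<in>G i. \<kappa> w * vc w $ j)"
      by (intro sum_mono)
    also have "\<dots> = (\<Sum>w\<in>(\<Union>i\<in>I. G i). \<kappa> w * vc w $ j)"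
    proof (rule sum.UNION_disjoint[symmetric])
      show "\<forall>i\<in>I. \<forall>k\<in>I. i \<noteq> k \<longrightarrow> G i \<inter> G k = {}"
        using pure unfolding G_def by fastforce
    qed (auto simp: finG)
    also have "\<dots> \<le> (\<Sum>w\<in>C. \<kappa> w * vc w $ j)"
      using fin \<kappa>(1) P(6) by (intro sum_mono2) (auto simp: G_def)
    finally show False using \<kappa>(5)[of j] \<open>card I = 3\<close> by (simp add: field_simps)
  qed
  then show ?thesis unfolding satisfiable_def by blast
qed

theorem theorem4:
  fixes c :: "'q::finite \<Rightarrow> 'p::finite clause"
  assumes "is_3sat c"
    and "no_repeated_var c"
  shows "satisfiable c \<longleftrightarrow>
    (\<exists>T :: ('p, 'q) pt set.
       int (3 * CARD('p) + CARD('q)) simplex T \<and> S_pts \<subseteq> T \<and> T \<subseteq> P_poly c)"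
  using assms satisfiable_imp_simplex simplex_imp_satisfiable by blast

end
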